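(* Suppose that (A1)--(A3) of the context hold, along with the following two conditions: (i) the limit $\bar f_\infty(\theta)=\lim_{r\to\infty}r^{-1}\bar f(r\theta)$ exists for all $\theta\in\mathbb{R}^d$ and defines a continuous function $\bar f_\infty:\mathbb{R}^d\to\mathbb{R}^d$; (ii) the origin is globally asymptotically stable for the ODE $\frac{d}{dt}\vartheta^\infty_t=\bar f_\infty(\vartheta^\infty_t)$ on $\mathbb{R}^d$. Then the solution of $\frac{d}{dt}\Theta_t=a_tf(\Theta_t,\xi_t)$ converges to $\theta^*$ for each initial condition.
   Context: Setting. $\Omega$ is a subset of a Euclidean space, $f:\mathbb{R}^d\times\Omega\to\mathbb{R}^d$, $\xi:[0,\infty)\to\Omega$ is a deterministic probing signal, and $a:[0,\infty)\to[0,\infty)$ is a gain. The mean vector field is $\bar f(\theta)=\lim_{T\to\infty}\frac1T\int_0^T f(\theta,\xi_t)\,dt$, $\theta\in\mathbb{R}^d$. (A1) $a$ is non-negative, monotonically decreasing, $\lim_{t\to\infty}a_t=0$ and $\int_0^\infty a_r\,dr=\infty$. (A2) There is $\ell_f<\infty$ such that $\|\bar f(\theta')-\bar f(\theta)\|\le \ell_f\|\theta'-\theta\|$ and $\|f(\theta',\xi)-f(\theta,\xi)\|\le \ell_f\|\theta'-\theta\|$ for all $\theta,\theta'\in\mathbb{R}^d$, $\xi\in\Omega$; and there is $b_0<\infty$ such that for all $\theta\in\mathbb{R}^d$, $T>0$: $\left\|\frac1T\int_0^T f(\theta,\xi_t)\,dt-\bar f(\theta)\right\|\le \frac{b_0}{T}(1+\|\theta\|)$.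 (A3) The ODE $\frac{d}{dt}\vartheta_t=\bar f(\vartheta_t)$ has a globally asymptotically stable equilibrium $\theta^*\in\mathbb{R}^d$. *)

theory Defs
  imports "HOL-Analysis.Analysis"
begin

definition ode_solution :: "('a::euclidean_space \<Rightarrow> 'a) \<Rightarrow> (real \<Rightarrow> 'a) \<Rightarrow> bool" where
  "ode_solution F x \<longleftrightarrow>
     (\<forall>t\<ge>0. (x has_vector_derivative F (x t)) (at t within {0..}))"

text \<open>
  Existence of solutions is not part of this notion: it ranges over all solutions on the whole
  half-line, and is meant for globally Lipschitz fields, for which there is exactly one solution
  on the half-line through each initial point.
\<close>

definition globally_asymptotically_stable ::
    "('a::euclidean_space \<Rightarrow> 'a) \<Rightarrow> 'a \<Rightarrow> bool" where
  "globally_asymptotically_stable F p \<longleftrightarrow>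
     F p = 0 \<and>
     (\<forall>\<epsilon>>0. \<exists>\<delta>>0. \<forall>x. ode_solution F x \<and> dist (x 0) p < \<delta> \<longrightarrow>
        (\<forall>t\<ge>0. dist (x t) p < \<epsilon>)) \<and>
     (\<forall>x. ode_solution F x \<longrightarrow> (x \<longlongrightarrow> p) at_top)"

text \<open>
  Solutions of the non-autonomous equation are taken in the sense of its integral form, since the
  gain and the probing signal need not be continuous in time. The integral is the
  Henstock--Kurzweil one, so every function that is differentiable on the half-line and satisfies
  the equation pointwise is a solution, and so is every Caratheodory (locally absolutely
  continuous) solution.
\<close>

definition qsa_solution ::
    "(real \<Rightarrow> real) \<Rightarrow> ('a::euclidean_space \<Rightarrow> 'b \<Rightarrow> 'a) \<Rightarrow> (real \<Rightarrow> 'b) \<Rightarrow> (real \<Rightarrow> 'a) \<Rightarrow> bool" where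
  "qsa_solution a f \<xi> \<Theta> \<longleftrightarrow>
     (\<forall>t\<ge>0. ((\<lambda>r. a r *\<^sub>R f (\<Theta> r) (\<xi> r)) has_integral (\<Theta> t - \<Theta> 0)) {0..t})"

end

theory Submission
  imports Defs "HOL-Complex_Analysis.Great_Picard"
begin

text \<open>
  In the clock \<open>\<tau> = \<integral> a\<close> the solution becomes a curve \<open>X\<close> which on every short interval \<open>[u, v]\<close>
  follows the Euler step of the mean field up to an error
  \<open>(\<epsilon> u + C (v - u)\<^sup>2) (1 + \<parallel>X u\<parallel>)\<close> with \<open>\<epsilon> u \<longlonglongrightarrow> 0\<close>: as \<open>a\<close> is monotone, the second mean value
  theorem bounds the contribution of the noise \<open>f(\<theta>, \<xi>) - fbar(\<theta>)\<close> at frozen \<open>\<theta>\<close> by a multiple of \<open>a\<close>.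
  Shifts \<open>X(t\<^sub>n + s)\<close> with \<open>t\<^sub>n \<longlonglongrightarrow> \<infinity>\<close> subconverge to solutions of the mean-field equation, and
  rescaled shifts \<open>X(t\<^sub>n + s) / \<parallel>X(t\<^sub>n)\<parallel>\<close> with \<open>\<parallel>X(t\<^sub>n)\<parallel> \<longlonglongrightarrow> \<infinity>\<close> to solutions of the scaled equation.
  Attractivity of the origin for the latter forces \<open>\<parallel>X\<parallel>\<close> to drop below its present value
  within bounded time whenever it is large, so \<open>X\<close> is bounded; attractivity and stability of
  the equilibrium for the former then give convergence.
\<close>

subsection \<open>Limits of approximate solutions\<close>

text \<open>A quadratic remainder is o(|z - t|), so \<open>G (y t)\<close> is the derivative at
  \<open>t\<close>. The hypothesis is two-sided in \<open>z\<close> because the derivative within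
  \<open>{0..}\<close> sees both sides of every \<open>t > 0\<close>; the constant may vary with
  \<open>t\<close>.\<close>

lemma ode_solution_if_quadratic_error:
  fixes y :: "real \<Rightarrow> 'a::euclidean_space"
  assumes "\<delta> > 0"
    and "\<And>t. t \<ge> 0 \<Longrightarrow> \<exists>M. \<forall>z\<ge>0. \<bar>z - t\<bar> \<le> \<delta> \<longrightarrow>
           norm (y z - y t - (z - t) *\<^sub>R G (y t)) \<le> M * (z - t)\<^sup>2"
  shows "ode_solution G y"
  unfolding ode_solution_def has_vector_derivative_def has_derivative_within_alt
proof (intro allI impI conjI)
  fix t e :: real assume t: "0 \<le> t" and e: "e > 0"
  obtain M where M: "\<And>z. z\<ge>0 \<Longrightarrow> \<bar>z - t\<bar> \<le> \<delta> \<Longrightarrow>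
      norm (y z - y t - (z - t) *\<^sub>R G (y t)) \<le> M * (z - t)\<^sup>2"
    using assms(2)[OF t] by blast
  define d where "d = min \<delta> (e / (\<bar>M\<bar> + 1))"
  have "d > 0" using assms(1) e by (simp add: d_def)
  moreover have "norm (y z - y t - (z - t) *\<^sub>R G (y t)) \<le> e * norm (z - t)"
    if "z \<in> {0..}" "norm (z - t) < d" for z
  proof -
    have "norm (y z - y t - (z - t) *\<^sub>R G (y t)) \<le> M * (z - t)\<^sup>2"
      using that by (intro M) (auto simp: d_def)
    also have "\<dots> \<le> (\<bar>M\<bar> + 1) * \<bar>z - t\<bar> * \<bar>z - t\<bar>"
      using mult_right_mono[of M "\<bar>M\<bar> + 1" "(z - t)\<^sup>2"] by (simp add: power2_eq_square mult.assoc)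
    also have "\<dots> \<le> e * \<bar>z - t\<bar>"
      using that by (intro mult_right_mono) (auto simp: d_def field_simps)
    finally show ?thesis by simp
  qed
  ultimately show "\<exists>d>0. \<forall>z\<in>{0..}. norm (z - t) < d \<longrightarrow>
      norm (y z - y t - (z - t) *\<^sub>R G (y t)) \<le> e * norm (z - t)" by blast
qed (rule bounded_linear_scaleR_left)

text \<open>An Arzela-Ascoli argument for curves that are equicontinuous only up to the vanishing
  error \<open>\<epsilon> n\<close>: a diagonal subsequence converges at the rationals, hence
  everywhere, and the Euler estimate passes to the limit without its \<open>\<epsilon>\<close> term.
  Convergence is stated along moving times \<open>\<sigma> n\<close>, since the stability argument
  later evaluates the curves at such times.\<close>

lemma limit_of_approximate_solutions:
  fixes Y :: "nat \<Rightarrow> real \<Rightarrow> 'a::euclidean_space"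
  assumes \<delta>: "\<delta> > 0" and C: "C \<ge> 0" and L: "L \<ge> 0"
    and lip: "\<And>n x y. norm (g n x - g n y) \<le> L * norm (x - y)"
    and glim: "\<And>x. (\<lambda>n. g n x) \<longlonglongrightarrow> G x"
    and eps: "\<epsilon> \<longlonglongrightarrow> 0"
    and bdd: "\<And>S. \<exists>K. \<forall>n. \<forall>s\<in>{0..S}. norm (Y n s) \<le> K"
    and est: "\<And>n u v. 0 \<le> u \<Longrightarrow> u \<le> v \<Longrightarrow> v \<le> u + \<delta> \<Longrightarrow>
      norm (Y n v - Y n u - (v - u) *\<^sub>R g n (Y n u)) \<le> (\<epsilon> n + C * (v - u)\<^sup>2) * (1 + norm (Y n u))"
  obtains r y where "strict_mono (r :: nat \<Rightarrow> nat)" "ode_solution G y"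
    "\<And>\<sigma> s. (\<And>n. \<sigma> n \<ge> 0) \<Longrightarrow> \<sigma> \<longlonglongrightarrow> s \<Longrightarrow> (\<lambda>n. Y (r n) (\<sigma> n)) \<longlonglongrightarrow> y s"
proof -
  obtain B where B: "\<And>n. norm (g n 0) \<le> B"
    using convergent_imp_Bseq[of "\<lambda>n. g n 0"] glim[of 0] by (meson BseqE convergentI)
  have B0: "B \<ge> 0" using B[of 0] norm_ge_zero[of "g 0 0"] by linarith
  have gB: "norm (g n x) \<le> B + L * norm x" for n x
    using lip[of n x 0] B[of n] norm_triangle_sub[of "g n x" "g n 0"] by simp
  \<comment> \<open>A Lipschitz bound uniform in \<open>n\<close>, up to a slack of order
    \<open>\<epsilon> n\<close>. On the ball of radius \<open>K\<close> containing the curves the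
    field is at most \<open>B + L * K\<close>, and one factor of \<open>(v - u)\<^sup>2\<close> is
    traded for \<open>\<delta>\<close>.\<close>
  have equi: "\<exists>M\<ge>0. \<forall>n. \<forall>u\<in>{0..S}. \<forall>v\<in>{0..S}. \<bar>v - u\<bar> \<le> \<delta> \<longrightarrow>
      norm (Y n v - Y n u) \<le> M * (\<bar>\<epsilon> n\<bar> + \<bar>v - u\<bar>)" for S
  proof -
    obtain K0 where "\<And>n s. s\<in>{0..S} \<Longrightarrow> norm (Y n s) \<le> K0" using bdd by blast
    then obtain K where K: "\<And>n s. s\<in>{0..S} \<Longrightarrow> norm (Y n s) \<le> K" and K0: "K \<ge> 0"
      by (meson max.cobounded1 max.cobounded2 order.trans)
    define M where "M = (1 + K) * (1 + C * \<delta>) + B + L * K"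
    have M0: "M \<ge> 0" unfolding M_def using K0 C \<delta> B0 L by simp
    have *: "norm (Y n v - Y n u) \<le> M * (\<bar>\<epsilon> n\<bar> + (v - u))"
      if "u \<in> {0..S}" "v \<in> {0..S}" "u \<le> v" "v - u \<le> \<delta>" for n u v
    proof -
      have "norm (Y n v - Y n u) \<le> norm ((v - u) *\<^sub>R g n (Y n u))
          + norm (Y n v - Y n u - (v - u) *\<^sub>R g n (Y n u))"
        by (rule norm_triangle_sub)
      also have "\<dots> \<le> (v - u) * (B + L * K) + (\<epsilon> n + C * (v - u)\<^sup>2) * (1 + norm (Y n u))"
      proof (rule add_mono)
        have "norm (g n (Y n u)) \<le> B + L * K"
          using gB[of n "Y n u"] mult_left_mono[OF K[OF that(1), of n] L] by linarith
        then show "norm ((v - u) *\<^sub>R g n (Y n u)) \<le> (v - u) * (B + L * K)"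
          using that by (simp add: mult_left_mono)
        show "norm (Y n v - Y n u - (v - u) *\<^sub>R g n (Y n u)) \<le> (\<epsilon> n + C * (v - u)\<^sup>2) * (1 + norm (Y n u))"
          using est that by simp
      qed
      also have "(\<epsilon> n + C * (v - u)\<^sup>2) * (1 + norm (Y n u))
          \<le> (\<bar>\<epsilon> n\<bar> + C * \<delta> * (v - u)) * (1 + K)"
      proof (rule mult_mono)
        have "(v - u)\<^sup>2 \<le> \<delta> * (v - u)" using that by (simp add: power2_eq_square mult_right_mono)
        from mult_left_mono[OF this C]
        show "\<epsilon> n + C * (v - u)\<^sup>2 \<le> \<bar>\<epsilon> n\<bar> + C * \<delta> * (v - u)" by (simp add: mult.assoc)
      qed (use that K C \<delta> in auto)
      also have "(v - u) * (B + L * K) + (\<bar>\<epsilon> n\<bar> + C * \<delta> * (v - u)) * (1 + K)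
        \<le> M * (\<bar>\<epsilon> n\<bar> + (v - u))"
      proof -
        have "M * (\<bar>\<epsilon> n\<bar> + (v - u)) - ((v - u) * (B + L * K) + (\<bar>\<epsilon> n\<bar> + C * \<delta> * (v - u)) * (1 + K))
          = \<bar>\<epsilon> n\<bar> * ((1 + K) * (C * \<delta>) + B + L * K) + (v - u) * (1 + K)"
          unfolding M_def by (simp add: algebra_simps)
        also have "\<dots> \<ge> 0" using K0 C \<delta> B0 L that by simp
        finally show ?thesis by simp
      qed
      finally show ?thesis by simp
    qed
    have "norm (Y n v - Y n u) \<le> M * (\<bar>\<epsilon> n\<bar> + \<bar>v - u\<bar>)"
      if "u \<in> {0..S}" "v \<in> {0..S}" "\<bar>v - u\<bar> \<le> \<delta>" for n u v
      using *[of u v n] *[of v u n] that by (cases "u \<le> v") (auto simp: norm_minus_commute)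
    then show ?thesis using M0 by blast
  qed
  obtain k where k: "\<And>n s. s \<ge> 0 \<Longrightarrow> norm (Y n s) \<le> k s"
  proof -
    have "\<exists>K. \<forall>n. \<forall>s'\<in>{0..s}. norm (Y n s') \<le> K" for s by (rule bdd)
    then obtain k where "\<And>s n s'. s'\<in>{0..s} \<Longrightarrow> norm (Y n s') \<le> k s" by metis
    then show ?thesis using that[of k] by auto
  qed
  have k0: "0 \<le> k s" if "s \<ge> 0" for s using k[OF that, of 0] norm_ge_zero order.trans by blast
  \<comment> \<open>\<open>function_convergent_subsequence\<close> needs one bound for all arguments, hence the weights.\<close>
  have "countable (\<rat> \<inter> {0..} :: real set)" using countable_rat by blast
  moreover have "norm ((1 / (1 + k s)) *\<^sub>R Y n s) \<le> 1" if "s \<in> \<rat> \<inter> {0..}" for n s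
    using k[of s n] k0[of s] that by (auto simp: divide_simps)
  ultimately obtain r :: "nat \<Rightarrow> nat" where r: "strict_mono r" and
    rlim: "\<And>s. s \<in> \<rat> \<inter> {0..} \<Longrightarrow> \<exists>l. (\<lambda>n. (1 / (1 + k s)) *\<^sub>R Y (r n) s) \<longlonglongrightarrow> l"
    by (rule function_convergent_subsequence[where f = "\<lambda>n s. (1 / (1 + k s)) *\<^sub>R Y n s" and M = 1])
      metis+
  have epsr: "(\<lambda>n. \<epsilon> (r n)) \<longlonglongrightarrow> 0"
    using LIMSEQ_subseq_LIMSEQ[OF eps r] by (simp add: o_def)
  have ratconv: "convergent (\<lambda>n. Y (r n) s)" if s: "s \<in> \<rat>" "s \<ge> 0" for s
  proof -
    obtain l where "(\<lambda>n. (1 / (1 + k s)) *\<^sub>R Y (r n) s) \<longlonglongrightarrow> l"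
      using rlim[of s] s by blast
    from tendsto_scaleR[OF tendsto_const this, of "1 + k s"] show ?thesis
      using k0[OF s(2)] by (auto simp: convergent_def)
  qed
  have conv: "convergent (\<lambda>n. Y (r n) s)" if s: "s \<ge> 0" for s
  proof (rule Cauchy_convergent, rule metric_CauchyI)
    fix e :: real assume e: "e > 0"
    obtain M where M0: "M \<ge> 0" and M: "\<And>n u v. u\<in>{0..s+1} \<Longrightarrow> v\<in>{0..s+1} \<Longrightarrow> \<bar>v - u\<bar> \<le> \<delta> \<Longrightarrow>
      norm (Y n v - Y n u) \<le> M * (\<bar>\<epsilon> n\<bar> + \<bar>v - u\<bar>)" using equi[of "s+1"] by blast
    \<comment> \<open>The slack and the time gap get \<open>e / (6 * (M + 1))\<close> each, so
      moving from \<open>s\<close> to \<open>q\<close> costs at most \<open>e / 3\<close>;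
      \<open>M + 1\<close> avoids dividing by zero. The bounds 1 and \<open>\<delta>\<close> keep
      \<open>q\<close> where \<open>M\<close> applies, and taking \<open>q\<close> to the right of
      \<open>s\<close> keeps it non-negative.\<close>
    define \<eta> where "\<eta> = min (min 1 \<delta>) (e / (6 * (M + 1)))"
    have \<eta>: "\<eta> > 0" using e M0 \<delta> by (simp add: \<eta>_def)
    obtain q where q: "q \<in> \<rat>" "s < q" "q < s + \<eta>" using Rats_dense_in_real[of s "s + \<eta>"] \<eta> by auto
    have qS: "q \<in> {0..s+1}" "q - s \<le> \<delta>" "q - s \<le> e / (6 * (M + 1))"
      using q s by (auto simp: \<eta>_def)
    have "eventually (\<lambda>n. \<bar>\<epsilon> (r n)\<bar> < e / (6 * (M + 1))) sequentially"
      using tendstoD[OF epsr, of "e / (6 * (M + 1))"] e M0 by (simp add: dist_norm)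
    then obtain N1 where N1: "\<And>n. n \<ge> N1 \<Longrightarrow> \<bar>\<epsilon> (r n)\<bar> < e / (6 * (M + 1))"
      by (auto simp: eventually_sequentially)
    obtain N2 where N2: "\<And>m n. m \<ge> N2 \<Longrightarrow> n \<ge> N2 \<Longrightarrow> dist (Y (r m) q) (Y (r n) q) < e / 3"
      using metric_CauchyD[OF convergent_Cauchy[OF ratconv[of q]], of "e/3"] q s e by auto
    have close: "dist (Y (r n) q) (Y (r n) s) \<le> e / 3" if "n \<ge> N1" for n
    proof -
      have "dist (Y (r n) q) (Y (r n) s) \<le> M * (\<bar>\<epsilon> (r n)\<bar> + \<bar>q - s\<bar>)"
        unfolding dist_norm by (rule M) (use qS s q in auto)
      also have "\<dots> \<le> M * (e / (6 * (M + 1)) + e / (6 * (M + 1)))"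
        using N1[OF that] qS q M0 by (intro mult_left_mono add_mono) auto
      also have "\<dots> \<le> (M + 1) * (e / (6 * (M + 1)) + e / (6 * (M + 1)))"
        using M0 e by (intro mult_right_mono) auto
      also have "\<dots> = e / 3"
      proof -
        have "x * (e / (6 * x) + e / (6 * x)) = e / 3" if "x \<noteq> 0" for x
          using that by (simp add: field_simps)
        from this[of "M + 1"] show ?thesis using M0 by simp
      qed
      finally show ?thesis .
    qed
    show "\<exists>N. \<forall>m\<ge>N. \<forall>n\<ge>N. dist (Y (r m) s) (Y (r n) s) < e"
    proof (intro exI[of _ "max N1 N2"] allI impI)
      fix m n assume "max N1 N2 \<le> m" "max N1 N2 \<le> n"
      then show "dist (Y (r m) s) (Y (r n) s) < e"
        using close[of m] close[of n] N2[of m n]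
          dist_triangle2[of "Y (r m) s" "Y (r n) s" "Y (r n) q"]
          dist_triangle[of "Y (r m) s" "Y (r n) q" "Y (r m) q"]
        by (simp add: dist_commute)
    qed
  qed
  define y where "y s = lim (\<lambda>n. Y (r n) s)" for s
  have y: "(\<lambda>n. Y (r n) s) \<longlonglongrightarrow> y s" if "s \<ge> 0" for s
    using conv[OF that] by (simp add: y_def convergent_LIMSEQ_iff)
  have cc: "(\<lambda>n. Y (r n) (\<sigma> n)) \<longlonglongrightarrow> y s" if \<sigma>0: "\<And>n. \<sigma> n \<ge> 0" and \<sigma>: "\<sigma> \<longlonglongrightarrow> s" for \<sigma> s
  proof -
    have s: "s \<ge> 0" using LIMSEQ_le_const[OF \<sigma>] \<sigma>0 by blast
    obtain M where M: "\<And>n u v. u\<in>{0..s+1} \<Longrightarrow> v\<in>{0..s+1} \<Longrightarrow> \<bar>v - u\<bar> \<le> \<delta> \<Longrightarrow>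
      norm (Y n v - Y n u) \<le> M * (\<bar>\<epsilon> n\<bar> + \<bar>v - u\<bar>)" using equi[of "s+1"] by blast
    have "eventually (\<lambda>n. \<bar>\<sigma> n - s\<bar> < min 1 \<delta>) sequentially"
      using tendstoD[OF \<sigma>, of "min 1 \<delta>"] \<delta> by (simp add: dist_norm)
    then have "eventually (\<lambda>n. norm (Y (r n) (\<sigma> n) - Y (r n) s) \<le> M * (\<bar>\<epsilon> (r n)\<bar> + \<bar>\<sigma> n - s\<bar>)) sequentially"
      by eventually_elim (use s \<sigma>0 in \<open>auto intro!: M\<close>)
    moreover have "(\<lambda>n. M * (\<bar>\<epsilon> (r n)\<bar> + \<bar>\<sigma> n - s\<bar>)) \<longlonglongrightarrow> M * (\<bar>0\<bar> + \<bar>s - s\<bar>)"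
      by (intro tendsto_intros epsr \<sigma>)
    then have "(\<lambda>n. M * (\<bar>\<epsilon> (r n)\<bar> + \<bar>\<sigma> n - s\<bar>)) \<longlonglongrightarrow> 0" by simp
    ultimately have "(\<lambda>n. Y (r n) (\<sigma> n) - Y (r n) s) \<longlonglongrightarrow> 0"
      by (rule Lim_null_comparison)
    from tendsto_add[OF this y[OF s]] show ?thesis by simp
  qed
  have Glip: "norm (G x - G z) \<le> L * norm (x - z)" for x z
    using LIMSEQ_le_const2[OF tendsto_norm[OF tendsto_diff[OF glim[of x] glim[of z]]]] lip by blast
  have glim': "(\<lambda>n. g (r n) (Y (r n) u)) \<longlonglongrightarrow> G (y u)" if "u \<ge> 0" for u
  proof -
    have "(\<lambda>n. g (r n) (Y (r n) u) - g (r n) (y u)) \<longlonglongrightarrow> 0"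
    proof (rule Lim_null_comparison)
      show "\<forall>\<^sub>F n in sequentially. norm (g (r n) (Y (r n) u) - g (r n) (y u)) \<le> L * norm (Y (r n) u - y u)"
        using lip by simp
      have "(\<lambda>n. L * norm (Y (r n) u - y u)) \<longlonglongrightarrow> L * norm (y u - y u)"
        by (intro tendsto_intros y that)
      then show "(\<lambda>n. L * norm (Y (r n) u - y u)) \<longlonglongrightarrow> 0" by simp
    qed
    from tendsto_add[OF this LIMSEQ_subseq_LIMSEQ[OF glim[of "y u"] r]]
    show ?thesis by (simp add: o_def)
  qed
  have yest: "norm (y v - y u - (v - u) *\<^sub>R G (y u)) \<le> C * (v - u)\<^sup>2 * (1 + norm (y u))"
    if "0 \<le> u" "u \<le> v" "v \<le> u + \<delta>" for u v
  proof -
    have "(\<lambda>n. norm (Y (r n) v - Y (r n) u - (v - u) *\<^sub>R g (r n) (Y (r n) u)))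
        \<longlonglongrightarrow> norm (y v - y u - (v - u) *\<^sub>R G (y u))"
      using that by (intro tendsto_intros y glim') auto
    moreover have "(\<lambda>n. (\<epsilon> (r n) + C * (v - u)\<^sup>2) * (1 + norm (Y (r n) u)))
        \<longlonglongrightarrow> (0 + C * (v - u)\<^sup>2) * (1 + norm (y u))"
      using that by (intro tendsto_intros y epsr) auto
    ultimately have "norm (y v - y u - (v - u) *\<^sub>R G (y u)) \<le> (0 + C * (v - u)\<^sup>2) * (1 + norm (y u))"
      by (rule LIMSEQ_le) (use est that in auto)
    then show ?thesis by simp
  qed
  have "ode_solution G y"
  proof (rule ode_solution_if_quadratic_error[OF \<delta>])
    fix t :: real assume t: "t \<ge> 0"
    obtain M where M: "\<And>n u v. u\<in>{0..t} \<Longrightarrow> v\<in>{0..t} \<Longrightarrow> \<bar>v - u\<bar> \<le> \<delta> \<Longrightarrow>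
      norm (Y n v - Y n u) \<le> M * (\<bar>\<epsilon> n\<bar> + \<bar>v - u\<bar>)" using equi[of t] by blast
    \<comment> \<open>In the limit the slack vanishes and a genuine Lipschitz bound to the left of
      \<open>t\<close> remains.\<close>
    have yM: "norm (y t - y z) \<le> M * (t - z)" if "z \<in> {0..t}" "t - z \<le> \<delta>" for z
    proof -
      have "(\<lambda>n. norm (Y (r n) t - Y (r n) z)) \<longlonglongrightarrow> norm (y t - y z)"
        using that t by (intro tendsto_intros y) auto
      moreover have "(\<lambda>n. M * (\<bar>\<epsilon> (r n)\<bar> + \<bar>t - z\<bar>)) \<longlonglongrightarrow> M * (\<bar>0\<bar> + \<bar>t - z\<bar>)"
        by (intro tendsto_intros epsr)
      ultimately have "norm (y t - y z) \<le> M * (\<bar>0\<bar> + \<bar>t - z\<bar>)"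
        by (rule LIMSEQ_le) (use M[of z t] that t in auto)
      then show ?thesis using that by simp
    qed
    obtain K where K: "\<And>n z. z \<in> {0..t} \<Longrightarrow> norm (Y n z) \<le> K" using bdd[of t] by blast
    have yK: "norm (y z) \<le> K" if "z \<in> {0..t}" for z
      using LIMSEQ_le_const2[OF tendsto_norm[OF y[of z]]] K that by auto
    show "\<exists>M. \<forall>z\<ge>0. \<bar>z - t\<bar> \<le> \<delta> \<longrightarrow>
           norm (y z - y t - (z - t) *\<^sub>R G (y t)) \<le> M * (z - t)\<^sup>2"
    proof (intro exI[of _ "C * (1 + K) + L * \<bar>M\<bar>"] allI impI)
      fix z :: real assume z: "0 \<le> z" "\<bar>z - t\<bar> \<le> \<delta>"
      have CK: "C * (z - t)\<^sup>2 * (1 + norm (y w)) \<le> C * (1 + K) * (z - t)\<^sup>2" if "w \<in> {0..t}" for w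
        using mult_left_mono[of "1 + norm (y w)" "1 + K" "C * (z - t)\<^sup>2"] yK[OF that] C
        by (simp add: algebra_simps)
      have LM: "0 \<le> L * \<bar>M\<bar> * (z - t)\<^sup>2" using L by simp
      show "norm (y z - y t - (z - t) *\<^sub>R G (y t)) \<le> (C * (1 + K) + L * \<bar>M\<bar>) * (z - t)\<^sup>2"
      proof (cases "t \<le> z")
        case True
        then show ?thesis using yest[of t z] z t CK[of t] LM by (simp add: distrib_right)
      next
        case False
        \<comment> \<open>The estimate \<open>yest\<close> is anchored at the left endpoint, here
          \<open>z\<close>. Replacing \<open>G (y z)\<close> by \<open>G (y t)\<close> costs a
          further quadratic term, by the Lipschitz bounds on \<open>G\<close> and
          \<open>y\<close>.\<close>
        have "y z - y t - (z - t) *\<^sub>R G (y t)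
          = - (y t - y z - (t - z) *\<^sub>R G (y z)) + (t - z) *\<^sub>R (G (y t) - G (y z))"
          by (simp add: algebra_simps)
        then have "norm (y z - y t - (z - t) *\<^sub>R G (y t))
          \<le> norm (y t - y z - (t - z) *\<^sub>R G (y z)) + norm ((t - z) *\<^sub>R (G (y t) - G (y z)))"
          by (metis norm_minus_cancel norm_triangle_ineq)
        also have "\<dots> \<le> C * (1 + K) * (z - t)\<^sup>2 + L * \<bar>M\<bar> * (z - t)\<^sup>2"
        proof (rule add_mono)
          show "norm (y t - y z - (t - z) *\<^sub>R G (y z)) \<le> C * (1 + K) * (z - t)\<^sup>2"
            using yest[of z t] z t False CK[of z] by (simp add: power2_commute)
          have "norm (y t - y z) \<le> M * (t - z)" using z False by (intro yM) auto
          also have "\<dots> \<le> \<bar>M\<bar> * (t - z)" using False by (intro mult_right_mono) auto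
          finally have "norm (G (y t) - G (y z)) \<le> L * (\<bar>M\<bar> * (t - z))"
            using order.trans[OF Glip[of "y t" "y z"]] L by (simp add: mult_left_mono)
          from mult_left_mono[OF this, of "t - z"] False
          have "norm ((t - z) *\<^sub>R (G (y t) - G (y z))) \<le> (t - z) * (L * (\<bar>M\<bar> * (t - z)))"
            by simp
          also have "\<dots> = L * \<bar>M\<bar> * (z - t)\<^sup>2" by (simp add: power2_eq_square algebra_simps)
          finally show "norm ((t - z) *\<^sub>R (G (y t) - G (y z))) \<le> L * \<bar>M\<bar> * (z - t)\<^sup>2" .
        qed
        finally show ?thesis by (simp add: distrib_right)
      qed
    qed
  qed
  from that[OF r this cc] show ?thesis by blast
qed

subsection \<open>Curves following a vector field asymptotically\<close>

text \<open>The factor \<open>1 + norm (X u)\<close> lets the estimate survive division of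
  \<open>X\<close> by any \<open>c \<ge> 1\<close>, so the same hypothesis serves plain and rescaled
  shifts. Monotonicity of \<open>\<epsilon>\<close> bounds the error along a whole shifted curve by
  its value at the shift.\<close>

locale approximate_flow =
  fixes X :: "real \<Rightarrow> 'a::euclidean_space" and F :: "'a \<Rightarrow> 'a"
    and \<epsilon> :: "real \<Rightarrow> real" and \<delta> C L :: real
  assumes \<delta>: "\<delta> > 0" and C: "C \<ge> 0" and L: "L \<ge> 0"
    and lip: "\<And>x y. norm (F x - F y) \<le> L * norm (x - y)"
    and cont: "\<And>S. continuous_on {0..S} X"
    and eps_nonneg: "\<And>t. 0 \<le> t \<Longrightarrow> 0 \<le> \<epsilon> t"
    and eps_antimono: "\<And>s t. 0 \<le> s \<Longrightarrow> s \<le> t \<Longrightarrow> \<epsilon> t \<le> \<epsilon> s"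
    and eps_lim: "(\<epsilon> \<longlongrightarrow> 0) at_top"
    and est: "\<And>u v. 0 \<le> u \<Longrightarrow> u \<le> v \<Longrightarrow> v \<le> u + \<delta> \<Longrightarrow>
      norm (X v - X u - (v - u) *\<^sub>R F (X u)) \<le> (\<epsilon> u + C * (v - u)\<^sup>2) * (1 + norm (X u))"
begin

text \<open>A discrete Gronwall argument: each step of length at most \<open>\<delta>\<close>
  multiplies \<open>1 + norm (X u)\<close> by at most \<open>A\<close>, and a fixed number of steps
  covers \<open>S\<close>. The factor is independent of the starting time.\<close>

lemma growth: "\<exists>K\<ge>0. \<forall>u\<ge>0. \<forall>s\<in>{0..S}. 1 + norm (X (u + s)) \<le> K * (1 + norm (X u))"
proof -
  define A where "A = 1 + \<epsilon> 0 + C * \<delta>\<^sup>2 + \<delta> * (norm (F 0) + L)"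
  have A0: "A \<ge> 0" unfolding A_def using eps_nonneg[of 0] C \<delta> L by simp
  have step: "1 + norm (X v) \<le> A * (1 + norm (X u))" if "0 \<le> u" "u \<le> v" "v \<le> u + \<delta>" for u v
  proof -
    have "norm (F (X u)) \<le> norm (F 0) + L * norm (X u)"
      using lip[of "X u" 0] norm_triangle_sub[of "F (X u)" "F 0"] by simp
    also have "\<dots> \<le> (norm (F 0) + L) * (1 + norm (X u))" using L by (simp add: algebra_simps)
    finally have F: "norm (F (X u)) \<le> (norm (F 0) + L) * (1 + norm (X u))" .
    have "X v = X u + (v - u) *\<^sub>R F (X u) + (X v - X u - (v - u) *\<^sub>R F (X u))" by simp
    then have "norm (X v) \<le> norm (X u) + norm ((v - u) *\<^sub>R F (X u))
        + norm (X v - X u - (v - u) *\<^sub>R F (X u))"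
      by (metis norm_triangle_mono norm_triangle_ineq order_refl)
    also have "\<dots> \<le> norm (X u) + \<delta> * ((norm (F 0) + L) * (1 + norm (X u)))
        + (\<epsilon> 0 + C * \<delta>\<^sup>2) * (1 + norm (X u))"
    proof (intro add_mono order_refl)
      show "norm ((v - u) *\<^sub>R F (X u)) \<le> \<delta> * ((norm (F 0) + L) * (1 + norm (X u)))"
        using F that \<delta> by (auto intro!: mult_mono)
      have "(v - u)\<^sup>2 \<le> \<delta>\<^sup>2" using that by (intro power_mono) auto
      then have "\<epsilon> u + C * (v - u)\<^sup>2 \<le> \<epsilon> 0 + C * \<delta>\<^sup>2"
        using eps_antimono[of 0 u] that C by (intro add_mono mult_left_mono) auto
      from order.trans[OF est[OF that] mult_right_mono[OF this]]
      show "norm (X v - X u - (v - u) *\<^sub>R F (X u)) \<le> (\<epsilon> 0 + C * \<delta>\<^sup>2) * (1 + norm (X u))" by simp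
    qed
    also have "\<dots> = A * (1 + norm (X u)) - 1" by (simp add: A_def algebra_simps)
    finally show ?thesis by simp
  qed
  \<comment> \<open>Needed when fewer steps suffice than \<open>n\<close> allows: then
    \<open>A\<close> is still below the higher power.\<close>
  have A1: "A \<ge> 1" unfolding A_def using eps_nonneg[of 0] C \<delta> L by simp
  have iter: "0 \<le> s \<Longrightarrow> s \<le> real n * \<delta> \<Longrightarrow> 1 + norm (X (u + s)) \<le> A ^ n * (1 + norm (X u))"
    if "u \<ge> 0" for u s n
  proof (induction n arbitrary: s)
    case (Suc n)
    show ?case
    proof (cases "s \<le> \<delta>")
      case True
      then have "1 + norm (X (u + s)) \<le> A * (1 + norm (X u))"
        using Suc.prems that by (intro step) auto
      also have "\<dots> \<le> A ^ Suc n * (1 + norm (X u))"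
        using power_increasing[of 1 "Suc n" A] A1 by (intro mult_right_mono) auto
      finally show ?thesis .
    next
      case False
      have "1 + norm (X (u + s)) \<le> A * (1 + norm (X (u + (s - \<delta>))))"
        using False that \<delta> by (intro step) auto
      also have "\<dots> \<le> A * (A ^ n * (1 + norm (X u)))"
        using Suc.prems False A0 by (intro mult_left_mono Suc.IH) (auto simp: algebra_simps)
      finally show ?thesis by simp
    qed
  qed simp
  obtain n :: nat where "S < real n * \<delta>" using reals_Archimedean3[OF \<delta>] by blast
  then have "\<forall>u\<ge>0. \<forall>s\<in>{0..S}. 1 + norm (X (u + s)) \<le> A ^ n * (1 + norm (X u))"
    by (intro allI impI ballI iter) auto
  then show ?thesis using zero_le_power[OF A0, of n] by blast
qed

text \<open>The map \<open>x \<mapsto> F (c x) / c\<close> keeps the Lipschitz constant of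
  \<open>F\<close>, and \<open>growth\<close> bounds the shifts uniformly on bounded time intervals.
  The choice \<open>c n = 1\<close> yields solutions for \<open>F\<close> itself, \<open>c n\<close>
  tending to infinity yields solutions for the scaled field.\<close>

lemma shifted_limit:
  fixes t c :: "nat \<Rightarrow> real"
  assumes t: "\<And>n. t n \<ge> 0" and tinf: "filterlim t at_top sequentially"
    and c: "\<And>n. c n \<ge> 1" and B: "\<And>n. norm (X (t n)) \<le> B * c n"
    and G: "\<And>x. (\<lambda>n. (1 / c n) *\<^sub>R F (c n *\<^sub>R x)) \<longlonglongrightarrow> G x"
  obtains r y where "strict_mono (r :: nat \<Rightarrow> nat)" "ode_solution G y"
    "\<And>\<sigma> s. (\<And>n. \<sigma> n \<ge> 0) \<Longrightarrow> \<sigma> \<longlonglongrightarrow> s \<Longrightarrow>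
      (\<lambda>n. (1 / c (r n)) *\<^sub>R X (t (r n) + \<sigma> n)) \<longlonglongrightarrow> y s"
proof -
  have c0: "c n > 0" for n using c[of n] by linarith
  have B0: "B \<ge> 0"
  proof -
    have "0 \<le> B * c 0" using B[of 0] norm_ge_zero order.trans by blast
    then show ?thesis using c0[of 0] by (simp add: zero_le_mult_iff)
  qed
  show thesis
  proof (rule limit_of_approximate_solutions[of \<delta> C L "\<lambda>n x. (1 / c n) *\<^sub>R F (c n *\<^sub>R x)" G
        "\<lambda>n. \<epsilon> (t n)" "\<lambda>n s. (1 / c n) *\<^sub>R X (t n + s)", OF \<delta> C L _ G])
    fix n x y
    have "norm ((1 / c n) *\<^sub>R F (c n *\<^sub>R x) - (1 / c n) *\<^sub>R F (c n *\<^sub>R y))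
        = (1 / c n) * norm (F (c n *\<^sub>R x) - F (c n *\<^sub>R y))"
      using c0[of n] by (simp flip: scaleR_diff_right)
    also have "\<dots> \<le> (1 / c n) * (L * norm (c n *\<^sub>R x - c n *\<^sub>R y))"
      using c0[of n] by (intro mult_left_mono lip) auto
    also have "\<dots> = L * norm (x - y)"
      using c0[of n] by (simp flip: scaleR_diff_right)
    finally show "norm ((1 / c n) *\<^sub>R F (c n *\<^sub>R x) - (1 / c n) *\<^sub>R F (c n *\<^sub>R y)) \<le> L * norm (x - y)" .
  next
    show "(\<lambda>n. \<epsilon> (t n)) \<longlonglongrightarrow> 0" using filterlim_compose[OF eps_lim tinf] .
  next
    fix S
    obtain K where K0: "K \<ge> 0" and
      K: "\<And>u s. u\<ge>0 \<Longrightarrow> s\<in>{0..S} \<Longrightarrow> 1 + norm (X (u + s)) \<le> K * (1 + norm (X u))"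
      using growth[of S] by blast
    have "norm ((1 / c n) *\<^sub>R X (t n + s)) \<le> K * (1 + B)" if "s \<in> {0..S}" for n s
    proof -
      have "norm (X (t n + s)) \<le> K * (1 + norm (X (t n)))" using K[OF t that, of n] by linarith
      also have "\<dots> \<le> K * (1 * c n + B * c n)"
        using B[of n] c[of n] K0 by (intro mult_left_mono) auto
      finally show ?thesis using c0[of n] by (simp add: field_simps)
    qed
    then show "\<exists>K. \<forall>n. \<forall>s\<in>{0..S}. norm ((1 / c n) *\<^sub>R X (t n + s)) \<le> K" by blast
  next
    fix n and u v :: real assume uv: "0 \<le> u" "u \<le> v" "v \<le> u + \<delta>"
    have "norm ((1 / c n) *\<^sub>R X (t n + v) - (1 / c n) *\<^sub>R X (t n + u) -
            (v - u) *\<^sub>R (1 / c n) *\<^sub>R F (c n *\<^sub>R (1 / c n) *\<^sub>R X (t n + u)))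
      = norm ((1 / c n) *\<^sub>R (X (t n + v) - X (t n + u) - ((t n + v) - (t n + u)) *\<^sub>R F (X (t n + u))))"
      using c0[of n] by (simp add: scaleR_diff_right)
    also have "\<dots> = (1 / c n) * norm (X (t n + v) - X (t n + u) - ((t n + v) - (t n + u)) *\<^sub>R F (X (t n + u)))"
      using c0[of n] by simp
    also have "\<dots> \<le> (1 / c n) * ((\<epsilon> (t n + u) + C * ((t n + v) - (t n + u))\<^sup>2) * (1 + norm (X (t n + u))))"
      using uv c0[of n] t[of n] by (intro mult_left_mono est) auto
    also have "\<dots> = (\<epsilon> (t n + u) + C * (v - u)\<^sup>2) * (1 / c n + norm ((1 / c n) *\<^sub>R X (t n + u)))"
      using c0[of n] by (simp add: field_simps)
    also have "\<dots> \<le> (\<epsilon> (t n) + C * (v - u)\<^sup>2) * (1 + norm ((1 / c n) *\<^sub>R X (t n + u)))"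
      using uv t[of n] c[of n] C eps_nonneg[of "t n + u"] eps_antimono[of "t n" "t n + u"]
        eps_nonneg[of "t n"]
      by (intro mult_mono add_mono) auto
    finally show "norm ((1 / c n) *\<^sub>R X (t n + v) - (1 / c n) *\<^sub>R X (t n + u) -
            (v - u) *\<^sub>R (1 / c n) *\<^sub>R F (c n *\<^sub>R (1 / c n) *\<^sub>R X (t n + u)))
      \<le> (\<epsilon> (t n) + C * (v - u)\<^sup>2) * (1 + norm ((1 / c n) *\<^sub>R X (t n + u)))" .
  qed (use that in blast)
qed

text \<open>If the norm failed to drop for longer and longer times from larger and larger values,
  rescaled shifts would converge to a solution of the scaled equation that stays outside the open
  unit ball. So excursions beyond a large radius have bounded duration, and \<open>growth\<close>
  bounds their height.\<close>

lemma bounded_if_scaled_attractive: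
  assumes G: "\<And>x. ((\<lambda>r. (1 / r) *\<^sub>R F (r *\<^sub>R x)) \<longlongrightarrow> G x) at_top"
    and attr: "\<And>y. ode_solution G y \<Longrightarrow> (y \<longlongrightarrow> 0) at_top"
  shows "\<exists>M. \<forall>t\<ge>0. norm (X t) \<le> M"
proof -
  have "\<exists>N::nat. \<forall>t\<ge>real N. real N \<le> norm (X t) \<longrightarrow> (\<exists>s\<in>{0..real N}. norm (X (t + s)) < norm (X t))"
  proof (rule ccontr)
    assume "\<not> ?thesis"
    then have "\<forall>n::nat. \<exists>t. t \<ge> real n \<and> real n \<le> norm (X t) \<and>
        (\<forall>s\<in>{0..real n}. norm (X t) \<le> norm (X (t + s)))"
      by (meson not_less)
    then obtain t where t: "\<And>n. t n \<ge> real n" "\<And>n. real n \<le> norm (X (t n))"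
      "\<And>n s. s\<in>{0..real n} \<Longrightarrow> norm (X (t n)) \<le> norm (X (t n + s))"
      by metis
    \<comment> \<open>The maximum secures \<open>c n \<ge> 1\<close> for \<open>n = 0\<close>; from
      \<open>n = 1\<close> on, \<open>c n\<close> is the norm itself.\<close>
    define c where "c n = max 1 (norm (X (t n)))" for n
    have c: "0 < c n" for n unfolding c_def by (rule less_le_trans[OF zero_less_one]) simp
    have "filterlim t at_top sequentially" "filterlim c at_top sequentially"
      by (rule filterlim_at_top_mono[OF filterlim_real_sequentially],
          use t in \<open>auto simp: c_def le_max_iff_disj\<close>)+
    note lim = this
    obtain r y where r: "strict_mono (r :: nat \<Rightarrow> nat)" and y: "ode_solution G y" and
      conv: "\<And>\<sigma> s. (\<And>n. \<sigma> n \<ge> 0) \<Longrightarrow> \<sigma> \<longlonglongrightarrow> s \<Longrightarrow>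
        (\<lambda>n. (1 / c (r n)) *\<^sub>R X (t (r n) + \<sigma> n)) \<longlonglongrightarrow> y s"
    proof (rule shifted_limit[of t c 1 G])
      show "t n \<ge> 0" for n using t(1)[of n] by linarith
      show "(\<lambda>n. (1 / c n) *\<^sub>R F (c n *\<^sub>R x)) \<longlonglongrightarrow> G x" for x
        using filterlim_compose[OF G lim(2)] .
    qed (use lim in \<open>auto simp: c_def\<close>)
    \<comment> \<open>Any fixed \<open>s\<close> eventually lies in the window
      \<open>{0..real (r n)}\<close> on which the norm does not fall below its initial
      value.\<close>
    have "norm (y s) \<ge> 1" if s: "s \<ge> 0" for s
    proof -
      have "(\<lambda>n. norm ((1 / c (r n)) *\<^sub>R X (t (r n) + s))) \<longlonglongrightarrow> norm (y s)"
        using s by (intro tendsto_norm conv[of "\<lambda>_. s"]) auto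
      moreover have "1 \<le> norm ((1 / c (r n)) *\<^sub>R X (t (r n) + s))"
        if n: "n \<ge> nat \<lceil>max 1 s\<rceil>" for n
      proof -
        have rn: "max 1 s \<le> real (r n)" using n seq_suble[OF r, of n] by linarith
        then have "c (r n) = norm (X (t (r n)))" using t(2)[of "r n"] by (simp add: c_def)
        moreover have "1 \<le> norm (X (t (r n)))" using rn t(2)[of "r n"] by linarith
        moreover have "norm (X (t (r n))) \<le> norm (X (t (r n) + s))"
          by (rule t(3)) (use rn s in auto)
        ultimately show ?thesis
          using c[of "r n"] by (simp add: pos_le_divide_eq)
      qed
      ultimately show ?thesis using LIMSEQ_le_const by blast
    qed
    moreover have "eventually (\<lambda>s. norm (y s) < 1 \<and> s \<ge> 0) at_top"
      using tendstoD[OF attr[OF y], of 1] eventually_ge_at_top[of 0]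
      by (auto elim: eventually_conj)
    then obtain s where "norm (y s) < 1" "s \<ge> 0"
      using eventually_happens'[OF trivial_limit_at_top_linorder] by blast
    ultimately show False by (meson not_less)
  qed
  then obtain N :: nat where N: "\<And>t. t \<ge> real N \<Longrightarrow> real N \<le> norm (X t) \<Longrightarrow>
      \<exists>s\<in>{0..real N}. norm (X (t + s)) < norm (X t)" by blast
  obtain K where K0: "K \<ge> 0" and
    K: "\<And>u s. u\<ge>0 \<Longrightarrow> s\<in>{0..real N} \<Longrightarrow> 1 + norm (X (u + s)) \<le> K * (1 + norm (X u))"
    using growth[of N] by blast
  \<comment> \<open>The first entry makes the dropping property \<open>N\<close> applicable at
    radius \<open>R\<close>; the second ensures that the ball is visited at time
    \<open>N\<close>.\<close>
  define R where "R = max (real N) (norm (X N))"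
  have late: "norm (X t) \<le> max R (K * (1 + R))" if t: "t \<ge> real N" for t
  proof (cases "norm (X t) \<le> R")
    case False
    have contN: "continuous_on {real N..t} (\<lambda>r. norm (X r))"
      by (intro continuous_on_norm continuous_on_subset[OF cont[of t]]) auto
    \<comment> \<open>From the last visit \<open>u\<close> to the ball of radius \<open>R\<close> before \<open>t\<close>, the norm must drop below \<open>R\<close> within
      time \<open>N\<close>, which cannot happen before \<open>t\<close>.\<close>
    define A where "A = {r \<in> {real N..t}. norm (X r) \<le> R}"
    have "closed A" unfolding A_def
      using continuous_closed_preimage[OF contN, of "{..R}"] by (simp add: vimage_def Int_def)
    moreover have "bounded A" unfolding A_def by (rule bounded_subset[of "{real N..t}"]) auto
    moreover have "A \<noteq> {}" unfolding A_def using t by (auto simp: R_def)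
    ultimately obtain u where u: "u \<in> A" "\<And>r. r \<in> A \<Longrightarrow> r \<le> u"
      using compact_attains_sup[of A] by (auto simp: compact_eq_bounded_closed)
    have "norm (X u) = R"
    proof -
      have "\<exists>w\<ge>u. w \<le> t \<and> norm (X w) = R"
        using u False continuous_on_subset[OF contN, of "{u..t}"]
        by (intro IVT') (auto simp: A_def)
      then obtain w where "w \<ge> u" "w \<le> t" "norm (X w) = R" by blast
      moreover have "w \<le> u" using calculation u(1) by (intro u(2)) (auto simp: A_def)
      ultimately show ?thesis by simp
    qed
    moreover have "real N \<le> u" using u(1) by (simp add: A_def)
    moreover have "real N \<le> R" by (simp add: R_def)
    ultimately obtain s where s: "s \<in> {0..real N}" "norm (X (u + s)) < R" using N[of u] by auto
    have "u + s > t"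
    proof (rule ccontr)
      assume "\<not> u + s > t"
      then have "u + s \<in> A" using u(1) s by (auto simp: A_def)
      then have "u + s \<le> u" by (rule u(2))
      then have "s = 0" using s by auto
      then show False using s \<open>norm (X u) = R\<close> by simp
    qed
    then have "1 + norm (X (u + (t - u))) \<le> K * (1 + norm (X u))"
      using u(1) s by (intro K) (auto simp: A_def)
    then show ?thesis using \<open>norm (X u) = R\<close> by simp
  qed simp
  \<comment> \<open>The last entry covers the times before \<open>N\<close>, by growth from time
    0.\<close>
  have "norm (X t) \<le> max (max R (K * (1 + R))) (K * (1 + norm (X 0)))" if "t \<ge> 0" for t
  proof (cases "t \<ge> N")
    case True then show ?thesis using late[of t] by simp
  next
    case False
    then show ?thesis using K[of 0 t] that by simp
  qed
  then show ?thesis by blast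
qed

text \<open>Attractivity brings \<open>X\<close> close to \<open>p\<close> in every late window of
  fixed length. If \<open>X\<close> were also far from \<open>p\<close> at arbitrarily late times, a
  limit of shifts started at the preceding close visits would be a solution that starts near
  \<open>p\<close> and leaves the \<open>e\<close>-ball, against stability.\<close>

lemma converges_if_bounded:
  assumes M: "\<And>t. t \<ge> 0 \<Longrightarrow> norm (X t) \<le> M"
    and gas: "globally_asymptotically_stable F p"
  shows "(X \<longlongrightarrow> p) at_top"
proof (rule ccontr)
  have limit: thesis if "\<And>n::nat. t n \<ge> 0" "filterlim t at_top sequentially"
    "\<And>r y. strict_mono (r :: nat \<Rightarrow> nat) \<Longrightarrow> ode_solution F y \<Longrightarrow>
      (\<And>\<sigma> s. (\<And>n. \<sigma> n \<ge> 0) \<Longrightarrow> \<sigma> \<longlonglongrightarrow> s \<Longrightarrow> (\<lambda>n. X (t (r n) + \<sigma> n)) \<longlonglongrightarrow> y s) \<Longrightarrow> thesis"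
    for t thesis
    by (rule shifted_limit[of t "\<lambda>_. 1" M F]) (use that M in \<open>auto\<close>)
  \<comment> \<open>Otherwise shifts avoiding the \<open>d\<close>-ball for ever longer times would
    converge to a solution that never enters it.\<close>
  have visits: "\<exists>N::nat. \<forall>t\<ge>real N. \<exists>s\<in>{0..real N}. dist (X (t + s)) p < d" if d: "d > 0" for d
  proof (rule ccontr)
    assume "\<not> ?thesis"
    then have "\<forall>n::nat. \<exists>t. t \<ge> real n \<and> (\<forall>s\<in>{0..real n}. d \<le> dist (X (t + s)) p)"
      by (meson not_less)
    then obtain t where t: "\<And>n. t n \<ge> real n"
      "\<And>n s. s\<in>{0..real n} \<Longrightarrow> d \<le> dist (X (t n + s)) p"
      by metis
    have "filterlim t at_top sequentially"
      by (rule filterlim_at_top_mono[OF filterlim_real_sequentially]) (use t in auto)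
    moreover have "t n \<ge> 0" for n using t(1)[of n] by linarith
    ultimately obtain r y where r: "strict_mono (r :: nat \<Rightarrow> nat)" and y: "ode_solution F y" and
      conv: "\<And>\<sigma> s. (\<And>n. \<sigma> n \<ge> 0) \<Longrightarrow> \<sigma> \<longlonglongrightarrow> s \<Longrightarrow> (\<lambda>n. X (t (r n) + \<sigma> n)) \<longlonglongrightarrow> y s"
      using limit[of t] by blast
    have "d \<le> dist (y s) p" if s: "s \<ge> 0" for s
    proof -
      have "(\<lambda>n. dist (X (t (r n) + s)) p) \<longlonglongrightarrow> dist (y s) p"
        using s by (intro tendsto_dist tendsto_const conv[of "\<lambda>_. s"]) auto
      moreover have "d \<le> dist (X (t (r n) + s)) p" if n: "n \<ge> nat \<lceil>s\<rceil>" for n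
      proof (rule t(2))
        have "s \<le> real (r n)" using n seq_suble[OF r, of n] by linarith
        then show "s \<in> {0..real (r n)}" using s by simp
      qed
      ultimately show ?thesis using LIMSEQ_le_const by blast
    qed
    moreover have "(y \<longlongrightarrow> p) at_top"
      using gas y by (simp add: globally_asymptotically_stable_def)
    then have "eventually (\<lambda>s. dist (y s) p < d \<and> s \<ge> 0) at_top"
      using tendstoD[of y p at_top d] d eventually_ge_at_top[of 0]
      by (auto elim: eventually_conj)
    then obtain s where "dist (y s) p < d" "s \<ge> 0"
      using eventually_happens'[OF trivial_limit_at_top_linorder] by blast
    ultimately show False by (meson not_less)
  qed
  assume "\<not> (X \<longlongrightarrow> p) at_top"
  then obtain e where e: "e > 0" and "\<not> eventually (\<lambda>t. dist (X t) p < e) at_top"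
    by (auto simp: tendsto_iff)
  then have far: "\<exists>t\<ge>T. e \<le> dist (X t) p" for T
    by (auto simp: eventually_at_top_linorder not_less)
  obtain d where d: "d > 0" and stable: "\<And>y t. ode_solution F y \<Longrightarrow> dist (y 0) p < d \<Longrightarrow> t \<ge> 0 \<Longrightarrow>
      dist (y t) p < e" using gas e unfolding globally_asymptotically_stable_def by meson
  \<comment> \<open>Strict inequalities weaken in the limit, so half the stability radius is
    used.\<close>
  obtain N :: nat where N: "\<And>t. t \<ge> real N \<Longrightarrow> \<exists>s\<in>{0..real N}. dist (X (t + s)) p < d / 2"
    using visits[of "d / 2"] d by auto
  have "\<exists>t \<sigma>. t \<ge> real n \<and> \<sigma> \<in> {0..real N} \<and> dist (X t) p < d / 2 \<and> e \<le> dist (X (t + \<sigma>)) p" for n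
  proof -
    \<comment> \<open>One \<open>N\<close> looks back for the close visit, the other makes that
      window late enough for \<open>N\<close> to apply.\<close>
    obtain t where t: "t \<ge> real n + 2 * real N" "e \<le> dist (X t) p" using far by blast
    obtain s where s: "s \<in> {0..real N}" "dist (X (t - real N + s)) p < d / 2"
      using N[of "t - real N"] t by auto
    show ?thesis
      by (rule exI[of _ "t - real N + s"], rule exI[of _ "real N - s"]) (use s t in auto)
  qed
  then obtain t \<sigma> where t: "\<And>n::nat. t n \<ge> real n" "\<And>n. \<sigma> n \<in> {0..real N}"
      "\<And>n. dist (X (t n)) p < d / 2" "\<And>n. e \<le> dist (X (t n + \<sigma> n)) p"
    by metis
  \<comment> \<open>The delays from close visit to far point lie in a compact interval; their limit
    \<open>s\<close> is the time at which the limiting solution is far from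
    \<open>p\<close>.\<close>
  obtain s q where q: "strict_mono (q :: nat \<Rightarrow> nat)" and s: "(\<sigma> \<circ> q) \<longlonglongrightarrow> s"
    using compact_Icc[of 0 "real N"] t(2) unfolding compact_def by metis
  have "real n \<le> t (q n)" for n
    using t(1)[of "q n"] seq_suble[OF q, of n] by linarith
  then have "filterlim (\<lambda>n. t (q n)) at_top sequentially"
    by (intro filterlim_at_top_mono[OF filterlim_real_sequentially]) auto
  moreover have "t (q n) \<ge> 0" for n using t(1)[of "q n"] by linarith
  ultimately obtain r y where r: "strict_mono (r :: nat \<Rightarrow> nat)" and y: "ode_solution F y" and
    conv: "\<And>\<sigma> s. (\<And>n. \<sigma> n \<ge> 0) \<Longrightarrow> \<sigma> \<longlonglongrightarrow> s \<Longrightarrow> (\<lambda>n. X (t (q (r n)) + \<sigma> n)) \<longlonglongrightarrow> y s"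
    using limit[of "\<lambda>n. t (q n)"] by blast
  have "(\<lambda>n. dist (X (t (q (r n)) + 0)) p) \<longlonglongrightarrow> dist (y 0) p"
    by (intro tendsto_dist tendsto_const conv[of "\<lambda>_. 0"]) auto
  then have "dist (y 0) p \<le> d / 2"
    by (rule LIMSEQ_le_const2) (use t(3) in \<open>auto intro: less_imp_le\<close>)
  moreover have "(\<lambda>n. dist (X (t (q (r n)) + \<sigma> (q (r n)))) p) \<longlonglongrightarrow> dist (y s) p"
    using t(2) LIMSEQ_subseq_LIMSEQ[OF s r]
    by (intro tendsto_dist tendsto_const conv[of "\<lambda>n. \<sigma> (q (r n))"]) (auto simp: o_def)
  then have "e \<le> dist (y s) p"
    by (rule LIMSEQ_le_const) (use t(4) in auto)
  moreover have "s \<ge> 0"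
    using LIMSEQ_le_const[OF s, of 0] t(2) by auto
  ultimately show False using stable[OF y, of s] d by auto
qed

end

subsection \<open>Averaging the probing signal\<close>

text \<open>The second mean value theorem for the constant 1 with weight \<open>- a\<close> includes
  integrability of the product; the sign turns the decreasing \<open>a\<close> into an increasing
  weight.\<close>

lemma monotone_integrable_on:
  fixes a :: "real \<Rightarrow> real"
  assumes "\<And>r s. u \<le> r \<Longrightarrow> r \<le> s \<Longrightarrow> s \<le> t \<Longrightarrow> a s \<le> a r"
  shows "a integrable_on {u..t}"
proof (cases "u \<le> t")
  case True
  have "(\<lambda>_. 1::real) integrable_on {u..t}" by (rule integrable_const_ivl)
  then obtain I where "((\<lambda>r. - a r * 1) has_integral I) {u..t}"
    by (rule second_mean_value_theorem_full[OF _ True, where g = "\<lambda>r. - a r"])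
      (simp add: assms, blast)
  from has_integral_neg[OF this] show ?thesis by (auto simp: integrable_on_def)
qed (auto simp: integrable_on_empty)

text \<open>In each coordinate the second mean value theorem turns the integral into
  \<open>a u\<close> and \<open>a t\<close> times integrals of \<open>h\<close> over subintervals.
  Each of these is a difference of two integrals from 0, hence at most \<open>2 * B\<close>, which
  gives \<open>4 * B * a u\<close> per coordinate. The bound is free of \<open>t\<close>:
  oscillations of \<open>h\<close> do not accumulate.\<close>

lemma monotone_weighted_integral:
  fixes h :: "real \<Rightarrow> 'a::euclidean_space" and a :: "real \<Rightarrow> real" and B :: real
  assumes ut: "0 \<le> u" "u \<le> t"
    and a0: "\<And>r. 0 \<le> r \<Longrightarrow> 0 \<le> a r"
    and a: "\<And>r s. 0 \<le> r \<Longrightarrow> r \<le> s \<Longrightarrow> a s \<le> a r"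
    and h: "\<And>T. h integrable_on {0..T}"
    and B: "\<And>T. T \<ge> 0 \<Longrightarrow> norm (integral {0..T} h) \<le> B"
  shows "(\<lambda>r. a r *\<^sub>R h r) integrable_on {u..t}"
    and "norm (integral {u..t} (\<lambda>r. a r *\<^sub>R h r)) \<le> 4 * DIM('a) * B * a u"
proof -
  have B0: "0 \<le> B" using B[of 0] by simp
  have hI: "h integrable_on {p..q}" if "0 \<le> p" for p q
    by (rule integrable_subinterval_real[OF h[of q]]) (use that in auto)
  have B2: "\<bar>integral {p..q} (\<lambda>r. h r \<bullet> i)\<bar> \<le> 2 * B" if "0 \<le> p" "p \<le> q" "i \<in> Basis" for p q i
  proof -
    have "integral {p..q} h = integral {0..q} h - integral {0..p} h"
      using Henstock_Kurzweil_Integration.integral_combine[of 0 p q h] that h by (simp add: algebra_simps)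
    then have "norm (integral {p..q} h) \<le> norm (integral {0..q} h) + norm (integral {0..p} h)"
      by (simp add: norm_triangle_ineq4)
    also have "\<dots> \<le> 2 * B" using B[of q] B[of p] that by simp
    finally have "norm (integral {p..q} h) \<le> 2 * B" .
    then show ?thesis
      using Basis_le_norm[OF that(3), of "integral {p..q} h"] that hI[OF that(1)]
      by (simp add: integral_component_eq)
  qed
  have comp: "\<exists>I. ((\<lambda>r. (a r *\<^sub>R h r) \<bullet> i) has_integral I) {u..t} \<and> \<bar>I\<bar> \<le> 4 * B * a u"
    if i: "i \<in> Basis" for i
  proof -
    have hi: "(\<lambda>r. h r \<bullet> i) integrable_on {u..t}"
      using hI[OF ut(1)] i by (simp add: integrable_component)
    obtain c where c: "c \<in> {u..t}" and
      "((\<lambda>r. - a r * (h r \<bullet> i)) has_integral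
         (- a u * integral {u..c} (\<lambda>r. h r \<bullet> i) + - a t * integral {c..t} (\<lambda>r. h r \<bullet> i))) {u..t}"
      using second_mean_value_theorem_full[OF hi ut(2), of "\<lambda>r. - a r"] a ut by auto
    from has_integral_neg[OF this(2)]
    have "((\<lambda>r. (a r *\<^sub>R h r) \<bullet> i) has_integral
         (a u * integral {u..c} (\<lambda>r. h r \<bullet> i) + a t * integral {c..t} (\<lambda>r. h r \<bullet> i))) {u..t}"
      by (simp add: add.commute)
    moreover have "\<bar>a u * integral {u..c} (\<lambda>r. h r \<bullet> i) + a t * integral {c..t} (\<lambda>r. h r \<bullet> i)\<bar>
      \<le> a u * (2 * B) + a u * (2 * B)"
    proof (rule order.trans[OF abs_triangle_ineq add_mono])
      show "\<bar>a u * integral {u..c} (\<lambda>r. h r \<bullet> i)\<bar> \<le> a u * (2 * B)"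
        using a0[of u] B2[of u c i] c ut i by (auto simp: abs_mult intro!: mult_left_mono)
      show "\<bar>a t * integral {c..t} (\<lambda>r. h r \<bullet> i)\<bar> \<le> a u * (2 * B)"
        using a0[of t] a0[of u] a[of u t] B2[of c t i] c ut i by (auto simp: abs_mult intro!: mult_mono)
    qed
    ultimately show ?thesis by (intro exI conjI) (assumption, simp)
  qed
  show int: "(\<lambda>r. a r *\<^sub>R h r) integrable_on {u..t}"
    using comp by (subst integrable_componentwise_iff) (auto simp: integrable_on_def)
  have "norm (integral {u..t} (\<lambda>r. a r *\<^sub>R h r))
      \<le> (\<Sum>i\<in>Basis. \<bar>integral {u..t} (\<lambda>r. a r *\<^sub>R h r) \<bullet> i\<bar>)"
    by (rule norm_le_l1)
  also have "\<dots> \<le> (\<Sum>i\<in>(Basis::'a set). 4 * B * a u)"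
  proof (rule sum_mono)
    fix i :: 'a assume i: "i \<in> Basis"
    from comp[OF i] obtain I where I: "((\<lambda>r. (a r *\<^sub>R h r) \<bullet> i) has_integral I) {u..t}" "\<bar>I\<bar> \<le> 4 * B * a u"
      by blast
    have "integral {u..t} (\<lambda>r. a r *\<^sub>R h r) \<bullet> i = I"
      using integral_component_eq[OF int, of i] I(1) by (simp add: integral_unique)
    then show "\<bar>integral {u..t} (\<lambda>r. a r *\<^sub>R h r) \<bullet> i\<bar> \<le> 4 * B * a u" using I(2) by simp
  qed
  finally show "norm (integral {u..t} (\<lambda>r. a r *\<^sub>R h r)) \<le> 4 * DIM('a) * B * a u"
    by (simp add: mult_ac)
qed

lemma qsa_solution_integral:
  assumes "qsa_solution a f \<xi> \<Theta>" "0 \<le> u" "u \<le> w"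
  shows "((\<lambda>r. a r *\<^sub>R f (\<Theta> r) (\<xi> r)) has_integral (\<Theta> w - \<Theta> u)) {u..w}"
proof -
  let ?h = "\<lambda>r. a r *\<^sub>R f (\<Theta> r) (\<xi> r)"
  have H: "(?h has_integral (\<Theta> t - \<Theta> 0)) {0..t}" if "t \<ge> 0" for t
    using assms(1) that by (simp add: qsa_solution_def)
  have hw: "?h integrable_on {0..w}" using H[of w] assms by (auto simp: integrable_on_def)
  have "?h integrable_on {u..w}"
    by (rule integrable_subinterval_real[OF hw]) (use assms in auto)
  moreover have "integral {u..w} ?h = \<Theta> w - \<Theta> u"
    using Henstock_Kurzweil_Integration.integral_combine[OF assms(2,3) hw]
      integral_unique[OF H[of u]] integral_unique[OF H[of w]] assms
    by (simp add: algebra_simps)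
  ultimately show ?thesis by (metis integrable_integral)
qed

lemma qsa_solution_continuous:
  assumes "qsa_solution a f \<xi> \<Theta>"
  shows "continuous_on {0..S} \<Theta>"
proof (cases "0 \<le> S")
  case True
  let ?h = "\<lambda>r. a r *\<^sub>R f (\<Theta> r) (\<xi> r)"
  have H: "(?h has_integral (\<Theta> t - \<Theta> 0)) {0..t}" if "t \<ge> 0" for t
    using assms that by (simp add: qsa_solution_def)
  have "?h integrable_on {0..S}" using H[OF True] by (auto simp: integrable_on_def)
  from indefinite_integral_continuous_1[OF this]
  have "continuous_on {0..S} (\<lambda>t. \<Theta> 0 + integral {0..t} ?h)" by (intro continuous_intros)
  then show ?thesis
    by (rule continuous_on_eq) (use integral_unique[OF H] in auto)
qed simp

text \<open>With \<open>\<theta> = \<Theta> u\<close> frozen, the integrand splits into the mean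
  field, the centred noise \<open>h\<close> and a Lipschitz remainder. Noise contributes at most
  \<open>N\<close>; the remainder is governed by the maximal deviation \<open>M\<close> of
  \<open>\<Theta>\<close> from \<open>\<theta>\<close>, which \<open>small\<close> allows to be
  bounded in terms of itself.\<close>

lemma qsa_local_estimate:
  fixes f :: "'a::euclidean_space \<Rightarrow> 'b \<Rightarrow> 'a" and a :: "real \<Rightarrow> real" and b :: real
  assumes lip: "\<And>\<theta> \<theta>' t. t \<ge> 0 \<Longrightarrow> norm (f \<theta>' (\<xi> t) - f \<theta> (\<xi> t)) \<le> l * norm (\<theta>' - \<theta>)"
    and l: "l \<ge> 0"
    and int: "\<And>\<theta> T. T > 0 \<Longrightarrow> (\<lambda>t. f \<theta> (\<xi> t)) integrable_on {0..T}"
    and a0: "\<And>r. 0 \<le> r \<Longrightarrow> 0 \<le> a r"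
    and a: "\<And>r s. 0 \<le> r \<Longrightarrow> r \<le> s \<Longrightarrow> a s \<le> a r"
    and erg: "\<And>\<theta> T. T > 0 \<Longrightarrow>
        norm ((1 / T) *\<^sub>R integral {0..T} (\<lambda>t. f \<theta> (\<xi> t)) - fbar \<theta>) \<le> b / T * (1 + norm \<theta>)"
    and b: "b \<ge> 0"
    and lin: "\<And>\<theta>. norm (fbar \<theta>) \<le> L * (1 + norm \<theta>)"
    and sol: "qsa_solution a f \<xi> \<Theta>"
    and ut: "0 \<le> u" "u \<le> t"
    and small: "l * integral {u..t} a \<le> 1 / 2"
  shows "norm (\<Theta> t - \<Theta> u - integral {u..t} a *\<^sub>R fbar (\<Theta> u))
    \<le> (8 * DIM('a) * b * a u + 2 * l * L * (integral {u..t} a)\<^sup>2) * (1 + norm (\<Theta> u))"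
proof -
  define \<theta> where "\<theta> = \<Theta> u"
  define h where "h r = f \<theta> (\<xi> r) - fbar \<theta>" for r
  define \<alpha> where "\<alpha> w = integral {u..w} a" for w
  define N where "N = 4 * DIM('a) * (b * (1 + norm \<theta>)) * a u"
  have N0: "N \<ge> 0" unfolding N_def using b a0[OF ut(1)] by simp
  \<comment> \<open>The hypothesis \<open>int\<close> speaks of positive \<open>T\<close> only;
    other values are covered by restricting from \<open>max T 1\<close>.\<close>
  have intf: "(\<lambda>t. f \<theta> (\<xi> t)) integrable_on {0..T}" for T
    by (rule integrable_subinterval_real[OF int[of "max T 1"]]) auto
  have hint: "h integrable_on {0..T}" for T
    unfolding h_def by (intro integrable_diff intf integrable_const_ivl)
  have hB: "norm (integral {0..T} h) \<le> b * (1 + norm \<theta>)" if "T \<ge> 0" for T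
  proof (cases "T = 0")
    case False
    then have T: "T > 0" using that by simp
    have "integral {0..T} h = integral {0..T} (\<lambda>t. f \<theta> (\<xi> t)) - T *\<^sub>R fbar \<theta>"
      unfolding h_def using T by (subst integral_diff[OF intf integrable_const_ivl]) simp
    also have "\<dots> = T *\<^sub>R ((1 / T) *\<^sub>R integral {0..T} (\<lambda>t. f \<theta> (\<xi> t)) - fbar \<theta>)"
      using T by (simp add: algebra_simps)
    finally have "norm (integral {0..T} h)
        = T * norm ((1 / T) *\<^sub>R integral {0..T} (\<lambda>t. f \<theta> (\<xi> t)) - fbar \<theta>)"
      using T by simp
    also have "\<dots> \<le> T * (b / T * (1 + norm \<theta>))" using T by (intro mult_left_mono erg) auto
    finally show ?thesis using T by simp
  qed (use b in simp)
  have aint: "a integrable_on {u..w}" for w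
    by (rule monotone_integrable_on) (use a ut in auto)
  have \<alpha>_mono: "0 \<le> \<alpha> w" "\<alpha> w \<le> \<alpha> t" if "w \<in> {u..t}" for w
  proof -
    show "0 \<le> \<alpha> w" unfolding \<alpha>_def using a0 ut by (intro integral_nonneg aint) auto
    show "\<alpha> w \<le> \<alpha> t" unfolding \<alpha>_def
      using a0 ut that by (intro integral_subset_le aint) auto
  qed
  define ah where "ah r = a r *\<^sub>R h r" for r
  have ah: "ah integrable_on {u..w}" "norm (integral {u..w} ah) \<le> N" if "u \<le> w" for w
    using monotone_weighted_integral[OF ut(1) that, of a h "b * (1 + norm \<theta>)"] a0 a hint hB
    unfolding N_def ah_def by auto
  have "continuous_on {u..t} (\<lambda>r. norm (\<Theta> r - \<theta>))"
    using qsa_solution_continuous[OF sol, of t] ut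
    by (intro continuous_intros) (auto elim: continuous_on_subset)
  from continuous_attains_sup[OF compact_Icc _ this] ut
  obtain m where m: "m \<in> {u..t}" "\<And>r. r \<in> {u..t} \<Longrightarrow> norm (\<Theta> r - \<theta>) \<le> norm (\<Theta> m - \<theta>)"
    by auto
  define M where "M = norm (\<Theta> m - \<theta>)"
  have main: "norm (\<Theta> w - \<theta> - \<alpha> w *\<^sub>R fbar \<theta>) \<le> N + l * M * \<alpha> w" if w: "w \<in> {u..t}" for w
  proof -
    define d where "d r = a r *\<^sub>R f (\<Theta> r) (\<xi> r) - (ah r + a r *\<^sub>R fbar \<theta>)" for r
    have d: "(d has_integral (\<Theta> w - \<Theta> u - (integral {u..w} ah + \<alpha> w *\<^sub>R fbar \<theta>))) {u..w}"
      unfolding d_def \<alpha>_def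
      using w ut by (intro has_integral_diff has_integral_add qsa_solution_integral[OF sol]
          integrable_integral ah has_integral_scaleR_left aint) auto
    have "norm (integral {u..w} d) \<le> integral {u..w} (\<lambda>r. l * M * a r)"
    proof (rule integral_norm_bound_integral)
      show "d integrable_on {u..w}" using d by blast
      show "(\<lambda>r. l * M * a r) integrable_on {u..w}" using aint by (intro integrable_on_mult_right)
      fix r assume r: "r \<in> {u..w}"
      have "d r = a r *\<^sub>R (f (\<Theta> r) (\<xi> r) - f \<theta> (\<xi> r))"
        by (simp add: d_def ah_def h_def algebra_simps)
      then have "norm (d r) = a r * norm (f (\<Theta> r) (\<xi> r) - f \<theta> (\<xi> r))" using a0[of r] r ut by simp
      also have "\<dots> \<le> a r * (l * norm (\<Theta> r - \<theta>))"
        using a0[of r] r ut by (intro mult_left_mono lip) auto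
      also have "\<dots> \<le> a r * (l * M)"
        using a0[of r] r ut w l m(2)[of r] unfolding M_def by (intro mult_left_mono) auto
      finally show "norm (d r) \<le> l * M * a r" by (simp add: mult_ac)
    qed
    then have "norm (\<Theta> w - \<Theta> u - (integral {u..w} ah + \<alpha> w *\<^sub>R fbar \<theta>)) \<le> l * M * \<alpha> w"
      using integral_unique[OF d] by (simp add: \<alpha>_def)
    moreover have "\<Theta> w - \<theta> - \<alpha> w *\<^sub>R fbar \<theta>
      = integral {u..w} ah + (\<Theta> w - \<Theta> u - (integral {u..w} ah + \<alpha> w *\<^sub>R fbar \<theta>))"
      by (simp add: \<theta>_def)
    ultimately show ?thesis
      using norm_triangle_ineq[of "integral {u..w} ah"
          "\<Theta> w - \<Theta> u - (integral {u..w} ah + \<alpha> w *\<^sub>R fbar \<theta>)"] ah(2)[of w] w by auto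
  qed
  have M0: "M \<ge> 0" by (simp add: M_def)
  have small': "l * \<alpha> t \<le> 1 / 2" using small by (simp add: \<alpha>_def)
  \<comment> \<open>Evaluating \<open>main\<close> at the maximizer \<open>m\<close> bounds
    \<open>M\<close> by known terms plus \<open>M / 2\<close>, which is absorbed on the
    left.\<close>
  have "M \<le> norm (\<alpha> m *\<^sub>R fbar \<theta>) + norm (\<Theta> m - \<theta> - \<alpha> m *\<^sub>R fbar \<theta>)"
    unfolding M_def by (rule norm_triangle_sub)
  also have "\<dots> \<le> \<alpha> t * (L * (1 + norm \<theta>)) + (N + M * (1 / 2))"
  proof (rule add_mono)
    show "norm (\<alpha> m *\<^sub>R fbar \<theta>) \<le> \<alpha> t * (L * (1 + norm \<theta>))"
      using \<alpha>_mono[OF m(1)] lin[of \<theta>] by (auto intro!: mult_mono)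
    have "l * M * \<alpha> m \<le> l * M * \<alpha> t" using \<alpha>_mono[OF m(1)] l M0 by (intro mult_left_mono) auto
    also have "\<dots> \<le> M * (1 / 2)" using mult_left_mono[OF small' M0] by (simp add: mult_ac)
    finally show "norm (\<Theta> m - \<theta> - \<alpha> m *\<^sub>R fbar \<theta>) \<le> N + M * (1 / 2)" using main[OF m(1)] by simp
  qed
  finally have M: "M \<le> 2 * (N + \<alpha> t * (L * (1 + norm \<theta>)))" by simp
  have t: "t \<in> {u..t}" using ut by simp
  have "norm (\<Theta> t - \<theta> - \<alpha> t *\<^sub>R fbar \<theta>) \<le> N + (l * \<alpha> t) * M" using main[OF t] by (simp add: mult_ac)
  also have "\<dots> \<le> N + (l * \<alpha> t) * (2 * (N + \<alpha> t * (L * (1 + norm \<theta>))))"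
    using M l \<alpha>_mono[OF t] by (intro add_left_mono mult_left_mono) auto
  also have "\<dots> = N + 2 * N * (l * \<alpha> t) + 2 * l * L * (\<alpha> t)\<^sup>2 * (1 + norm \<theta>)"
    by (simp add: algebra_simps power2_eq_square)
  \<comment> \<open>The noise is thus counted twice, which turns the 4 in \<open>N\<close> into the
    8 of the claim.\<close>
  also have "\<dots> \<le> N + 2 * N * (1 / 2) + 2 * l * L * (\<alpha> t)\<^sup>2 * (1 + norm \<theta>)"
    using mult_left_mono[OF small', of "2 * N"] N0 by simp
  also have "\<dots> = (8 * DIM('a) * b * a u + 2 * l * L * (\<alpha> t)\<^sup>2) * (1 + norm \<theta>)"
    by (simp add: N_def algebra_simps)
  finally show ?thesis by (simp add: \<alpha>_def \<theta>_def)
qed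

subsection \<open>Change of clock\<close>

text \<open>The integral of \<open>a\<close> is a continuous, strictly increasing bijection of the
  half-line, because a decreasing gain with divergent integral never vanishes. Its inverse
  \<open>\<sigma>\<close> translates new time into original time.\<close>

lemma integral_clock_inverse:
  fixes a :: "real \<Rightarrow> real"
  assumes a0: "\<And>r. 0 \<le> r \<Longrightarrow> 0 \<le> a r"
    and a: "\<And>r s. 0 \<le> r \<Longrightarrow> r \<le> s \<Longrightarrow> a s \<le> a r"
    and div: "filterlim (\<lambda>T. integral {0..T} a) at_top at_top"
  obtains \<sigma> where
    "\<And>s. s \<ge> 0 \<Longrightarrow> \<sigma> s \<ge> 0" "\<And>s. s \<ge> 0 \<Longrightarrow> integral {0..\<sigma> s} a = s"
    "\<And>t. t \<ge> 0 \<Longrightarrow> \<sigma> (integral {0..t} a) = t"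
    "\<And>s t. 0 \<le> s \<Longrightarrow> s \<le> t \<Longrightarrow> \<sigma> s \<le> \<sigma> t"
    "\<And>s t. 0 \<le> s \<Longrightarrow> s \<le> t \<Longrightarrow> integral {\<sigma> s..\<sigma> t} a = t - s"
    "\<And>S. continuous_on {0..S} \<sigma>"
    "filterlim \<sigma> at_top at_top"
proof -
  define \<tau> where "\<tau> t = integral {0..t} a" for t
  have aint: "a integrable_on {u..w}" if "u \<ge> 0" for u w
    by (rule monotone_integrable_on) (use a that in auto)
  have add: "\<tau> w = \<tau> u + integral {u..w} a" if "0 \<le> u" "u \<le> w" for u w
    unfolding \<tau>_def
    using Henstock_Kurzweil_Integration.integral_combine[OF that aint[of 0 w]] by simp
  \<comment> \<open>Once zero, \<open>a\<close> stays zero by monotonicity, and its integral would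
    stop growing.\<close>
  have pos: "a t > 0" if t: "t \<ge> 0" for t
  proof (rule ccontr)
    assume "\<not> a t > 0"
    then have zero: "a r = 0" if "r \<ge> t" for r using a[OF t that] a0[of r] that t by simp
    have const: "\<tau> w = \<tau> t" if "w \<ge> t" for w
    proof -
      have "integral {t..w} a = integral {t..w} (\<lambda>_. 0)" by (rule integral_cong) (use zero in auto)
      then show ?thesis using add[OF t that] by simp
    qed
    have "eventually (\<lambda>w. \<tau> t + 1 \<le> \<tau> w \<and> t \<le> w) at_top"
      using div unfolding \<tau>_def filterlim_at_top
      by (intro eventually_conj eventually_ge_at_top) auto
    then obtain w where "\<tau> t + 1 \<le> \<tau> w" "t \<le> w"
      using eventually_happens'[OF trivial_limit_at_top_linorder] by blast
    then show False using const[of w] by linarith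
  qed
  have less: "\<tau> u < \<tau> w" if "0 \<le> u" "u < w" for u w
  proof -
    have "integral {u..w} (\<lambda>_. a w) \<le> integral {u..w} a"
      using that a by (intro integral_le aint integrable_const_ivl) auto
    moreover have "integral {u..w} (\<lambda>_. a w) > 0" using that pos[of w] by simp
    ultimately show ?thesis using add[of u w] that by simp
  qed
  have cont: "continuous_on {0..S} \<tau>" for S
    unfolding \<tau>_def by (rule indefinite_integral_continuous_1) (simp add: aint)
  have \<tau>0: "\<tau> 0 = 0" by (simp add: \<tau>_def)
  have "\<exists>t\<ge>0. \<tau> t = s" if s: "s \<ge> 0" for s
  proof -
    have "eventually (\<lambda>w. s \<le> \<tau> w \<and> 0 \<le> w) at_top"
      using div unfolding \<tau>_def filterlim_at_top
      by (intro eventually_conj eventually_ge_at_top) auto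
    then obtain w where "s \<le> \<tau> w" "0 \<le> w" by (auto simp: eventually_at_top_linorder)
    then show ?thesis using IVT'[of \<tau> 0 s w] cont s \<tau>0 by auto
  qed
  then obtain \<sigma> where \<sigma>: "\<And>s. s \<ge> 0 \<Longrightarrow> \<sigma> s \<ge> 0" "\<And>s. s \<ge> 0 \<Longrightarrow> \<tau> (\<sigma> s) = s" by metis
  have \<tau>_nonneg: "\<tau> t \<ge> 0" if "t \<ge> 0" for t using less[of 0 t] that \<tau>0 by (cases "t = 0") auto
  have inv: "\<sigma> (\<tau> t) = t" if t: "t \<ge> 0" for t
    using \<sigma>[OF \<tau>_nonneg[OF t]] less[of t "\<sigma> (\<tau> t)"] less[of "\<sigma> (\<tau> t)" t] t
    by (cases "\<sigma> (\<tau> t)" t rule: linorder_cases) auto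
  have mono: "\<sigma> s \<le> \<sigma> t" if "0 \<le> s" "s \<le> t" for s t
    using less[of "\<sigma> t" "\<sigma> s"] \<sigma>(1)[of t] \<sigma>(2)[of t] \<sigma>(2)[of s] that by (cases "\<sigma> s \<le> \<sigma> t") auto
  have "continuous_on {0..S} \<sigma>" for S
  proof (cases "0 \<le> S")
    case True
    \<comment> \<open>A continuous injection on a compact set has a continuous inverse on its
      image.\<close>
    have "continuous_on (\<tau> ` {0..\<sigma> S}) \<sigma>"
      by (rule continuous_on_inv[OF cont compact_Icc]) (use inv in auto)
    moreover have "{0..S} \<subseteq> \<tau> ` {0..\<sigma> S}"
    proof
      fix s assume "s \<in> {0..S}"
      then have "s = \<tau> (\<sigma> s)" "\<sigma> s \<in> {0..\<sigma> S}" using \<sigma> mono by auto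
      then show "s \<in> \<tau> ` {0..\<sigma> S}" by blast
    qed
    ultimately show ?thesis by (rule continuous_on_subset)
  qed simp
  moreover have "filterlim \<sigma> at_top at_top"
    unfolding filterlim_at_top
  proof
    fix Z :: real
    have "Z \<le> \<sigma> s" if "s \<ge> \<tau> (max Z 0)" for s
      using mono[OF \<tau>_nonneg that] inv[of "max Z 0"] by simp
    then show "eventually (\<lambda>s. Z \<le> \<sigma> s) at_top" by (auto simp: eventually_at_top_linorder)
  qed
  moreover have "integral {\<sigma> s..\<sigma> t} a = t - s" if "0 \<le> s" "s \<le> t" for s t
    using add[OF \<sigma>(1)[OF that(1)] mono[OF that]] \<sigma>(2)[of s] \<sigma>(2)[of t] that by simp
  ultimately show thesis
    using that[of \<sigma>] \<sigma> inv mono unfolding \<tau>_def by blast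
qed

section \<open>Convergence to the equilibrium of the mean field\<close>

theorem theoremA1:
  fixes \<Omega> :: "'b::euclidean_space set"
    and f :: "real ^ 'd \<Rightarrow> 'b \<Rightarrow> real ^ 'd"
    and \<xi> :: "real \<Rightarrow> 'b"
    and a :: "real \<Rightarrow> real"
    and fbar finf :: "real ^ 'd \<Rightarrow> real ^ 'd"
    and l\<^sub>f b\<^sub>0 :: real
    and \<theta>s :: "real ^ 'd"
  assumes probing: "\<And>t. t \<ge> 0 \<Longrightarrow> \<xi> t \<in> \<Omega>"
    and integrable: "\<And>\<theta> T. T > 0 \<Longrightarrow> (\<lambda>t. f \<theta> (\<xi> t)) integrable_on {0..T}"
    and mean_field:
      "\<And>\<theta>. ((\<lambda>T. (1 / T) *\<^sub>R integral {0..T} (\<lambda>t. f \<theta> (\<xi> t))) \<longlongrightarrow> fbar \<theta>) at_top"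
    and A1_nonneg: "\<And>t. t \<ge> 0 \<Longrightarrow> a t \<ge> 0"
    and A1_decreasing: "\<And>s t. 0 \<le> s \<Longrightarrow> s \<le> t \<Longrightarrow> a t \<le> a s"
    and A1_limit: "(a \<longlongrightarrow> 0) at_top"
    and A1_divergent: "filterlim (\<lambda>T. integral {0..T} a) at_top at_top"
    and A2_lipschitz_mean: "\<And>\<theta> \<theta>'. norm (fbar \<theta>' - fbar \<theta>) \<le> l\<^sub>f * norm (\<theta>' - \<theta>)"
    and A2_lipschitz: "\<And>\<theta> \<theta>' z. z \<in> \<Omega> \<Longrightarrow> norm (f \<theta>' z - f \<theta> z) \<le> l\<^sub>f * norm (\<theta>' - \<theta>)"
    and A2_ergodic:
      "\<And>\<theta> T. T > 0 \<Longrightarrow>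
        norm ((1 / T) *\<^sub>R integral {0..T} (\<lambda>t. f \<theta> (\<xi> t)) - fbar \<theta>)
          \<le> b\<^sub>0 / T * (1 + norm \<theta>)"
    and A3: "globally_asymptotically_stable fbar \<theta>s"
    and scaled_limit: "\<And>\<theta>. ((\<lambda>r::real. (1 / r) *\<^sub>R fbar (r *\<^sub>R \<theta>)) \<longlongrightarrow> finf \<theta>) at_top"
    and scaled_continuous: "continuous_on UNIV finf"
    and scaled_stable: "globally_asymptotically_stable finf 0"
  shows "\<forall>\<theta>\<^sub>0 \<Theta>. qsa_solution a f \<xi> \<Theta> \<and> \<Theta> 0 = \<theta>\<^sub>0 \<longrightarrow> (\<Theta> \<longlongrightarrow> \<theta>s) at_top"
proof (intro allI impI)
  fix \<theta>\<^sub>0 \<Theta> assume "qsa_solution a f \<xi> \<Theta> \<and> \<Theta> 0 = \<theta>\<^sub>0"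
  then have sol: "qsa_solution a f \<xi> \<Theta>" by simp
  define l where "l = \<bar>l\<^sub>f\<bar>"
  have l: "l \<ge> 0" by (simp add: l_def)
  have lip_mono: "l\<^sub>f * norm x \<le> l * norm x" for x :: "real ^ 'd"
    unfolding l_def by (intro mult_right_mono) auto
  have lip: "norm (f \<theta>' (\<xi> t) - f \<theta> (\<xi> t)) \<le> l * norm (\<theta>' - \<theta>)" if "t \<ge> 0" for \<theta> \<theta>' t
    using A2_lipschitz[OF probing[OF that]] lip_mono order.trans by blast
  have lipbar: "norm (fbar x - fbar y) \<le> l * norm (x - y)" for x y
    using A2_lipschitz_mean lip_mono order.trans by blast
  \<comment> \<open>At \<open>T = 1\<close> and \<open>\<theta> = 0\<close> the right-hand side of
    the averaging bound is \<open>b\<^sub>0\<close> itself.\<close>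
  have b0: "b\<^sub>0 \<ge> 0" using order.trans[OF norm_ge_zero A2_ergodic[of 1 0]] by simp
  define L where "L = norm (fbar 0) + l"
  have L: "L \<ge> 0" using l by (simp add: L_def)
  have lin: "norm (fbar \<theta>) \<le> L * (1 + norm \<theta>)" for \<theta>
  proof -
    have "norm (fbar \<theta>) \<le> norm (fbar 0) + l * norm \<theta>"
      using norm_triangle_sub[of "fbar \<theta>" "fbar 0"] lipbar[of \<theta> 0] by simp
    also have "\<dots> \<le> L * (1 + norm \<theta>)" using l by (simp add: L_def algebra_simps)
    finally show ?thesis .
  qed
  obtain \<sigma> where \<sigma>: "\<And>s. s \<ge> 0 \<Longrightarrow> \<sigma> s \<ge> 0" and \<sigma>_inv: "\<And>t. t \<ge> 0 \<Longrightarrow> \<sigma> (integral {0..t} a) = t"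
    and \<sigma>_mono: "\<And>s t. 0 \<le> s \<Longrightarrow> s \<le> t \<Longrightarrow> \<sigma> s \<le> \<sigma> t"
    and \<sigma>_int: "\<And>s t. 0 \<le> s \<Longrightarrow> s \<le> t \<Longrightarrow> integral {\<sigma> s..\<sigma> t} a = t - s"
    and \<sigma>_cont: "\<And>S. continuous_on {0..S} \<sigma>" and \<sigma>_lim: "filterlim \<sigma> at_top at_top"
    by (rule integral_clock_inverse[of a, OF A1_nonneg A1_decreasing A1_divergent]) blast+
  define D where "D = 8 * DIM(real ^ 'd) * b\<^sub>0"
  have D: "D \<ge> 0" using b0 by (simp add: D_def)
  \<comment> \<open>The step length gives \<open>l * (v - u) \<le> 1 / 2\<close>, the smallness
    demanded by \<open>qsa_local_estimate\<close>; \<open>l + 1\<close> covers \<open>l = 0\<close>.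
    In the new clock the gain integral over a step is just \<open>v - u\<close>.\<close>
  interpret approximate_flow "\<lambda>s. \<Theta> (\<sigma> s)" fbar "\<lambda>s. D * a (\<sigma> s)" "1 / (2 * (l + 1))" "2 * l * L" l
  proof
    show "continuous_on {0..S} (\<lambda>s. \<Theta> (\<sigma> s))" for S
      by (rule continuous_on_compose2[OF qsa_solution_continuous[OF sol, of "\<sigma> S"] \<sigma>_cont])
        (use \<sigma> \<sigma>_mono in auto)
    have "((\<lambda>s. D * a (\<sigma> s)) \<longlongrightarrow> D * 0) at_top"
      by (intro tendsto_mult tendsto_const filterlim_compose[OF A1_limit \<sigma>_lim])
    then show "((\<lambda>s. D * a (\<sigma> s)) \<longlongrightarrow> 0) at_top" by simp
    fix u v :: real assume uv: "0 \<le> u" "u \<le> v" "v \<le> u + 1 / (2 * (l + 1))"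
    have "l * (v - u) \<le> l * (1 / (2 * (l + 1)))" using uv l by (intro mult_left_mono) auto
    also have "\<dots> \<le> 1 / 2" using l by (simp add: field_simps)
    finally show "norm (\<Theta> (\<sigma> v) - \<Theta> (\<sigma> u) - (v - u) *\<^sub>R fbar (\<Theta> (\<sigma> u)))
        \<le> (D * a (\<sigma> u) + 2 * l * L * (v - u)\<^sup>2) * (1 + norm (\<Theta> (\<sigma> u)))"
      using qsa_local_estimate[where f = f and fbar = fbar and \<xi> = \<xi> and a = a and b = b\<^sub>0 and L = L
          and l = l and \<Theta> = \<Theta> and u = "\<sigma> u" and t = "\<sigma> v",
          OF lip l integrable A1_nonneg A1_decreasing A2_ergodic b0 lin sol \<sigma>[OF uv(1)] \<sigma>_mono[OF uv(1,2)]]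
        \<sigma>_int[OF uv(1,2)]
      by (simp add: D_def)
  qed (use l L D lipbar \<sigma> \<sigma>_mono A1_nonneg A1_decreasing in \<open>auto intro!: mult_left_mono\<close>)
  obtain M where "\<And>s. s \<ge> 0 \<Longrightarrow> norm (\<Theta> (\<sigma> s)) \<le> M"
    using bounded_if_scaled_attractive[OF scaled_limit] scaled_stable
    unfolding globally_asymptotically_stable_def by blast
  from converges_if_bounded[OF this A3] have "((\<lambda>s. \<Theta> (\<sigma> s)) \<longlongrightarrow> \<theta>s) at_top" .
  \<comment> \<open>Substituting the gain integral for \<open>s\<close> returns to original time,
    where \<open>\<sigma>\<close> undoes it.\<close>
  from filterlim_compose[OF this A1_divergent]
  show "(\<Theta> \<longlongrightarrow> \<theta>s) at_top"
    by (rule Lim_transform_eventually)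
      (use \<sigma>_inv in \<open>auto intro: eventually_mono[OF eventually_ge_at_top[of 0]]\<close>)
qed

end
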